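(* For all $t\in\mathcal T=[t_0;t_1]$ and all walk matrices $\mathfrak D(t)=(d_{ij}(t))_{i,j\in\mathbb Z}\in\mathcal{WM}(\mathbb R)$, the series $$\|\mathfrak D\|_\infty=\max_{i}\sum_{j}|d_{ij}|$$ diverges (that is, $\|\mathfrak D(t)\|_\infty$ is not finite).
   Context: Walk matrices: let $(M,g)$ be a Riemannian manifold (with arbitrary metric $g$) such that $\dim M>0$ and $\sup_{x,y\in M}\operatorname{dist}(x,y)<+\infty$, where $\operatorname{dist}$ is the geodesic distance. Let $\mathcal T=[t_0;t_1]$ be a time interval and let $\{\xi_k(t)\}_{k\in\mathbb Z}$ be a countable set of points of $M$ depending on time $t\in\mathcal T$, each describing a finite path (a walk). The abstract squared distance matrix is the infinite matrix $\mathfrak D(t)(n,m)=d_{nm}(t)=\operatorname{dist}(\xi_n(t),\xi_m(t))^2$, $n,m\in\mathbb Z$. The set of walk matrices is $\mathcal{WM}(\mathbb R)=\{\mathfrak D(t)\mid \forall t\in\mathcal T:\ d_{ii}(t)=0,\ d_{ij}(t)>0\ \text{for all } i\ne j\}$. Indices $i,j$ range over $\mathbb Z$. *)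

theory Defs
  imports "HOL-Analysis.Analysis"
begin

section \<open>Smooth manifolds\<close>

fun Ck_on :: "nat \<Rightarrow> 'a::euclidean_space set \<Rightarrow> ('a \<Rightarrow> 'b::real_normed_vector) \<Rightarrow> bool" where
  "Ck_on 0 S f \<longleftrightarrow> continuous_on S f"
| "Ck_on (Suc k) S f \<longleftrightarrow>
     (\<forall>x\<in>S. f differentiable (at x)) \<and>
     (\<forall>v. Ck_on k S (\<lambda>x. frechet_derivative f (at x) v))"

text \<open>Used on open sets only, so that derivatives at points of the set are two-sided.\<close>

definition smooth_on :: "'a::euclidean_space set \<Rightarrow> ('a \<Rightarrow> 'b::real_normed_vector) \<Rightarrow> bool" where
  "smooth_on S f \<longleftrightarrow> (\<forall>k. Ck_on k S f)"

text \<open>A chart is a domain \<open>U\<close> together with a coordinate map; the values of the map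
  outside \<open>U\<close> are irrelevant.\<close>

type_synonym ('a, 'e) chart = "'a set \<times> ('a \<Rightarrow> 'e)"

definition is_chart :: "'a topology \<Rightarrow> ('a, 'e::euclidean_space) chart \<Rightarrow> bool" where
  "is_chart X = (\<lambda>(U, \<phi>). openin X U \<and> open (\<phi> ` U) \<and>
     homeomorphic_map (subtopology X U) (top_of_set (\<phi> ` U)) \<phi>)"

definition transition :: "('a, 'e) chart \<Rightarrow> ('a, 'e) chart \<Rightarrow> 'e \<Rightarrow> 'e" where
  "transition = (\<lambda>(U, \<phi>) (V, \<psi>). \<psi> \<circ> inv_into U \<phi>)"

text \<open>The manifold is the carrier of the topology \<open>X\<close>, and its dimension is \<open>DIM('e)\<close>.
  The atlas need not be maximal: every smooth atlas determines a unique smooth structure.\<close>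

definition smooth_manifold :: "'a topology \<Rightarrow> ('a, 'e::euclidean_space) chart set \<Rightarrow> bool" where
  "smooth_manifold X A \<longleftrightarrow>
     Hausdorff_space X \<and> second_countable X \<and>
     (\<forall>c\<in>A. is_chart X c) \<and> (\<Union>c\<in>A. fst c) = topspace X \<and>
     (\<forall>c\<in>A. \<forall>c'\<in>A. smooth_on (snd c ` (fst c \<inter> fst c')) (transition c c'))"


section \<open>Riemannian metrics and geodesic distance\<close>

text \<open>A metric tensor is given by its local representatives: \<open>g c p u v\<close> is the inner product
  at the point \<open>p\<close> of the tangent vectors with coordinates \<open>u\<close>, \<open>v\<close> in the chart \<open>c\<close>.
  The last conjunct is the transformation law of a covariant 2-tensor, the coordinates of
  tangent vectors being transformed by the differential of the chart transition.\<close>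

type_synonym ('a, 'e) metric_tensor = "('a, 'e) chart \<Rightarrow> 'a \<Rightarrow> 'e \<Rightarrow> 'e \<Rightarrow> real"

definition riemannian_metric ::
    "('a, 'e::euclidean_space) chart set \<Rightarrow> ('a, 'e) metric_tensor \<Rightarrow> bool" where
  "riemannian_metric A g \<longleftrightarrow>
     (\<forall>c\<in>A. \<forall>p\<in>fst c. bilinear (g c p) \<and> (\<forall>u v. g c p u v = g c p v u) \<and>
        (\<forall>u. u \<noteq> 0 \<longrightarrow> g c p u u > 0)) \<and>
     (\<forall>c\<in>A. \<forall>u v. smooth_on (snd c ` fst c) (\<lambda>x. g c (inv_into (fst c) (snd c) x) u v)) \<and>
     (\<forall>c\<in>A. \<forall>c'\<in>A. \<forall>p\<in>fst c \<inter> fst c'. \<forall>u v.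
        let D = frechet_derivative (transition c c') (at (snd c p))
        in g c p u v = g c' p (D u) (D v))"

definition riemannian_manifold ::
    "'a topology \<Rightarrow> ('a, 'e::euclidean_space) chart set \<Rightarrow> ('a, 'e) metric_tensor \<Rightarrow> bool" where
  "riemannian_manifold X A g \<longleftrightarrow> smooth_manifold X A \<and> riemannian_metric A g"

text \<open>Derivatives are taken within the closed interval, hence one-sided at its end points.
  The library's \<open>piecewise_C1_differentiable_on\<close> is weaker, as it allows the
  derivative to blow up at the break points.\<close>

definition C1_curve_on ::
    "('a, 'e::euclidean_space) chart set \<Rightarrow> real \<Rightarrow> real \<Rightarrow> (real \<Rightarrow> 'a) \<Rightarrow> bool" where
  "C1_curve_on A a b \<gamma> \<longleftrightarrow>
     (\<forall>(U, \<phi>)\<in>A. let J = {t\<in>{a..b}. \<gamma> t \<in> U} in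
        \<exists>\<gamma>'. continuous_on J \<gamma>' \<and>
             (\<forall>t\<in>J. ((\<phi> \<circ> \<gamma>) has_vector_derivative \<gamma>' t) (at t within J)))"

definition piecewise_C1_curve ::
    "'a topology \<Rightarrow> ('a, 'e::euclidean_space) chart set \<Rightarrow> real \<Rightarrow> real \<Rightarrow> (real \<Rightarrow> 'a) \<Rightarrow> bool" where
  "piecewise_C1_curve X A a b \<gamma> \<longleftrightarrow>
     a \<le> b \<and> continuous_map (top_of_set {a..b}) X \<gamma> \<and>
     (\<exists>(n::nat) s. s 0 = a \<and> s n = b \<and>
        (\<forall>i<n. s i \<le> s (Suc i) \<and> C1_curve_on A (s i) (s (Suc i)) \<gamma>))"

text \<open>By the transformation law the speed of a differentiable curve does not depend on the
  chosen chart.\<close>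

definition chart_at :: "('a, 'e) chart set \<Rightarrow> 'a \<Rightarrow> ('a, 'e) chart" where
  "chart_at A p = (SOME c. c \<in> A \<and> p \<in> fst c)"

definition speed ::
    "('a, 'e::euclidean_space) chart set \<Rightarrow> ('a, 'e) metric_tensor \<Rightarrow> (real \<Rightarrow> 'a) \<Rightarrow> real \<Rightarrow> real" where
  "speed A g \<gamma> t =
     (let c = chart_at A (\<gamma> t); v = vector_derivative (snd c \<circ> \<gamma>) (at t)
      in sqrt (g c (\<gamma> t) v v))"

definition curve_length ::
    "('a, 'e::euclidean_space) chart set \<Rightarrow> ('a, 'e) metric_tensor \<Rightarrow>
     real \<Rightarrow> real \<Rightarrow> (real \<Rightarrow> 'a) \<Rightarrow> ennreal" where
  "curve_length A g a b \<gamma> = (\<integral>\<^sup>+t\<in>{a..b}. ennreal (speed A g \<gamma> t) \<partial>lborel)"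

text \<open>The distance is \<open>\<infinity>\<close> between points in different connected components.\<close>

definition geodesic_dist ::
    "'a topology \<Rightarrow> ('a, 'e::euclidean_space) chart set \<Rightarrow> ('a, 'e) metric_tensor \<Rightarrow>
     'a \<Rightarrow> 'a \<Rightarrow> ennreal" where
  "geodesic_dist X A g x y =
     Inf {curve_length A g a b \<gamma> | a b \<gamma>. piecewise_C1_curve X A a b \<gamma> \<and> \<gamma> a = x \<and> \<gamma> b = y}"

definition diameter_of ::
    "'a topology \<Rightarrow> ('a, 'e::euclidean_space) chart set \<Rightarrow> ('a, 'e) metric_tensor \<Rightarrow> ennreal" where
  "diameter_of X A g = (SUP x\<in>topspace X. SUP y\<in>topspace X. geodesic_dist X A g x y)"


section \<open>Walk matrices\<close>

definition is_walk :: "'a topology \<Rightarrow> real \<Rightarrow> real \<Rightarrow> (real \<Rightarrow> 'a) \<Rightarrow> bool" where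
  "is_walk X t0 t1 w \<longleftrightarrow> continuous_map (top_of_set {t0..t1}) X w"

definition sq_dist_matrix ::
    "'a topology \<Rightarrow> ('a, 'e::euclidean_space) chart set \<Rightarrow> ('a, 'e) metric_tensor \<Rightarrow>
     (int \<Rightarrow> real \<Rightarrow> 'a) \<Rightarrow> real \<Rightarrow> int \<Rightarrow> int \<Rightarrow> real" where
  "sq_dist_matrix X A g \<xi> t n m = (enn2real (geodesic_dist X A g (\<xi> n t) (\<xi> m t)))\<^sup>2"

definition walk_matrices ::
    "'a topology \<Rightarrow> ('a, 'e::euclidean_space) chart set \<Rightarrow> ('a, 'e) metric_tensor \<Rightarrow>
     (int \<Rightarrow> real \<Rightarrow> 'a) \<Rightarrow> real set \<Rightarrow> (int \<Rightarrow> int \<Rightarrow> real) set" where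
  "walk_matrices X A g \<xi> T =
     {sq_dist_matrix X A g \<xi> t | t. t \<in> T \<and>
        (\<forall>s\<in>T. (\<forall>i. sq_dist_matrix X A g \<xi> s i i = 0) \<and>
               (\<forall>i j. i \<noteq> j \<longrightarrow> sq_dist_matrix X A g \<xi> s i j > 0))}"

text \<open>Computed in the extended nonnegative reals, where every series of nonnegative terms has
  a value; the maximum over the infinitely many rows is a supremum.\<close>

definition matrix_norm_inf :: "(int \<Rightarrow> int \<Rightarrow> real) \<Rightarrow> ennreal" where
  "matrix_norm_inf D = (SUP i. \<Sum>\<^sub>\<infinity>j\<in>UNIV. ennreal \<bar>D i j\<bar>)"

end

theory Submission
  imports Defs
begin

text \<open>The geodesic distance is symmetric and satisfies the triangle inequality, because
  piecewise \<open>C\<^sup>1\<close> curves can be reversed and concatenated. Hence, with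
  \<open>D i j\<close> the squared distance of the \<open>i\<close>-th and the \<open>j\<close>-th point,
  \<open>D 0 1 \<le> 2 (D 0 j + D 1 j)\<close> for every \<open>j\<close>. Summing this over all \<open>j\<close> shows that
  the rows 0 and 1 cannot both have a finite sum.

  No measurability of the speed is ever needed: the library's nonnegative integral of an
  arbitrary function is its lower integral, and this is subadditive over a measurable partition
  and invariant under reflections.\<close>

section \<open>Lower integrals\<close>

text \<open>The integral is the supremum over simple \<open>h\<close> below \<open>f\<close>. Each
  such \<open>h\<close> is measurable, so its integral splits exactly over \<open>B\<close> and its
  complement, and each piece is dominated by the corresponding piece of \<open>f\<close>.\<close>

lemma nn_integral_le_split:
  fixes f :: "'b \<Rightarrow> ennreal"
  assumes "B \<in> sets M"
  shows "(\<integral>\<^sup>+x. f x \<partial>M) \<le> (\<integral>\<^sup>+x\<in>B. f x \<partial>M) + (\<integral>\<^sup>+x\<in>space M - B. f x \<partial>M)"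
  unfolding nn_integral_def [of M f]
proof (rule SUP_least)
  fix h assume h: "h \<in> {h. simple_function M h \<and> h \<le> f}"
  then have [measurable]: "h \<in> borel_measurable M"
    by (auto intro: borel_measurable_simple_function)
  note [measurable] = assms
  have "integral\<^sup>S M h = (\<integral>\<^sup>+x. h x \<partial>M)"
    using h by (simp add: nn_integral_eq_simple_integral)
  also have "\<dots> = (\<integral>\<^sup>+x. h x * indicator B x + h x * indicator (space M - B) x \<partial>M)"
    by (intro nn_integral_cong) (auto simp: indicator_def)
  also have "\<dots> = (\<integral>\<^sup>+x\<in>B. h x \<partial>M) + (\<integral>\<^sup>+x\<in>space M - B. h x \<partial>M)"
    by (rule nn_integral_add) measurable
  also have "\<dots> \<le> (\<integral>\<^sup>+x\<in>B. f x \<partial>M) + (\<integral>\<^sup>+x\<in>space M - B. f x \<partial>M)"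
    using h by (intro add_mono nn_integral_mono mult_right_mono) (auto simp: le_fun_def)
  finally show "integral\<^sup>S M h \<le> (\<integral>\<^sup>+x\<in>B. f x \<partial>M) + (\<integral>\<^sup>+x\<in>space M - B. f x \<partial>M)" .
qed

text \<open>The change of variables is applied only to the simple functions below the integrand,
  which are measurable.\<close>

lemma nn_integral_lborel_reflect_le:
  fixes f :: "real \<Rightarrow> ennreal"
  shows "(\<integral>\<^sup>+x. f (c - x) \<partial>lborel) \<le> (\<integral>\<^sup>+x. f x \<partial>lborel)"
  unfolding nn_integral_def [of lborel "\<lambda>x. f (c - x)"]
proof (rule SUP_least)
  fix h assume h: "h \<in> {h. simple_function lborel h \<and> h \<le> (\<lambda>x. f (c - x))}"
  then have [measurable]: "h \<in> borel_measurable borel"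
    using borel_measurable_simple_function by fastforce
  have "integral\<^sup>S lborel h = (\<integral>\<^sup>+x. h x \<partial>lborel)"
    using h by (simp add: nn_integral_eq_simple_integral)
  also have "\<dots> = (\<integral>\<^sup>+x. h (c - x) \<partial>lborel)"
    using nn_integral_real_affine [of h "-1" c] by simp
  also have "\<dots> \<le> (\<integral>\<^sup>+x. f x \<partial>lborel)"
  proof (rule nn_integral_mono)
    \<comment> \<open>The bound on \<open>h\<close>, taken at \<open>c - x\<close>, reads
      \<open>h (c - x) \<le> f (c - (c - x))\<close>.\<close>
    fix x show "h (c - x) \<le> f x"
      using h by (auto simp: le_fun_def dest: spec [of _ "c - x"])
  qed
  finally show "integral\<^sup>S lborel h \<le> (\<integral>\<^sup>+x. f x \<partial>lborel)" .
qed


section \<open>Reversing curves\<close>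

text \<open>Chain rule with inner derivative \<open>-1\<close>. The set is mirrored as well because
  \<open>C1_curve_on\<close> takes derivatives within a set; mirroring twice gives back
  \<open>S\<close>.\<close>

lemma has_vector_derivative_reflect:
  assumes "(f has_vector_derivative f') (at (c - t) within S)"
  shows "((\<lambda>x. f (c - x)) has_vector_derivative - f') (at t within (\<lambda>x. c - x) ` S)"
proof -
  have *: "(\<lambda>x. c - x) ` (\<lambda>x. c - x) ` S = S"
    by (simp add: image_image)
  have "((\<lambda>x. c - x) has_vector_derivative -1) (at t within (\<lambda>x. c - x) ` S)"
    by (auto intro!: derivative_eq_intros)
  from vector_diff_chain_within [OF this, of f f'] show ?thesis
    using assms * by (simp add: o_def)
qed

lemma has_vector_derivative_reflect_iff:
  "((\<lambda>x. f (c - x)) has_vector_derivative f') (at (t::real)) \<longleftrightarrow>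
     (f has_vector_derivative - f') (at (c - t))"
proof -
  have UN: "(\<lambda>x. c - x) ` UNIV = (UNIV :: real set)"
    by (auto intro: image_eqI [of _ _ "c - _"])
  show ?thesis
    using has_vector_derivative_reflect [of f "- f'" c t UNIV]
      has_vector_derivative_reflect [of "\<lambda>x. f (c - x)" f' c "c - t" UNIV]
    by (auto simp: UN)
qed

text \<open>Where the derivative does not exist, both sides are the same junk value.\<close>

lemma vector_derivative_reflect:
  "vector_derivative (\<lambda>x. f (c - x)) (at t) = - vector_derivative f (at (c - t)) \<or>
   vector_derivative (\<lambda>x. f (c - x)) (at t) = vector_derivative f (at (c - t))"
proof (cases "\<exists>d. (f has_vector_derivative d) (at (c - t))")
  case True
  then obtain d where d: "(f has_vector_derivative d) (at (c - t))" by blast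
  then have "((\<lambda>x. f (c - x)) has_vector_derivative - d) (at t)"
    by (simp add: has_vector_derivative_reflect_iff)
  with d show ?thesis by (metis vector_derivative_at)
next
  case False
  then show ?thesis
    unfolding vector_derivative_def has_vector_derivative_reflect_iff by simp
qed

lemma chart_at:
  assumes "riemannian_manifold X A g" "p \<in> topspace X"
  shows "chart_at A p \<in> A" "p \<in> fst (chart_at A p)"
proof -
  have "p \<in> (\<Union>c\<in>A. fst c)"
    using assms unfolding riemannian_manifold_def smooth_manifold_def by simp
  then have "\<exists>c. c \<in> A \<and> p \<in> fst c" by blast
  from someI_ex [OF this] show "chart_at A p \<in> A" "p \<in> fst (chart_at A p)"
    unfolding chart_at_def by auto
qed

text \<open>Reflection changes the velocity at most by a sign, which the quadratic form of
  \<open>g\<close> ignores. Membership in \<open>topspace X\<close> ensures that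
  \<open>chart_at\<close> picks a chart of the atlas, where \<open>g\<close> is bilinear.\<close>

lemma speed_reflect:
  assumes "riemannian_manifold X A g" "\<gamma> (c - t) \<in> topspace X"
  shows "speed A g (\<lambda>x. \<gamma> (c - x)) t = speed A g \<gamma> (c - t)"
proof -
  let ?c = "chart_at A (\<gamma> (c - t))"
  have "bilinear (g ?c (\<gamma> (c - t)))"
    using assms(1) chart_at [OF assms]
    unfolding riemannian_manifold_def riemannian_metric_def by blast
  then have "g ?c (\<gamma> (c - t)) (- v) (- v) = g ?c (\<gamma> (c - t)) v v" for v
    by (simp add: bilinear_lneg bilinear_rneg)
  then show ?thesis
    using vector_derivative_reflect [of "snd ?c \<circ> \<gamma>" c t]
    by (auto simp: speed_def Let_def o_def)
qed

lemma C1_curve_on_reflect: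
  assumes "C1_curve_on A a b \<gamma>"
  shows "C1_curve_on A (c - b) (c - a) (\<lambda>t. \<gamma> (c - t))"
  unfolding C1_curve_on_def Let_def
proof (safe)
  fix U \<phi> assume "(U, \<phi>) \<in> A"
  define J where "J = {t\<in>{a..b}. \<gamma> t \<in> U}"
  have J': "{t \<in> {c - b..c - a}. \<gamma> (c - t) \<in> U} = (\<lambda>x. c - x) ` J"
    by (auto simp: J_def intro!: image_eqI [of _ _ "c - _"])
  obtain d where d: "continuous_on J d"
    "\<And>t. t \<in> J \<Longrightarrow> ((\<phi> \<circ> \<gamma>) has_vector_derivative d t) (at t within J)"
    using assms \<open>(U, \<phi>) \<in> A\<close> unfolding C1_curve_on_def J_def Let_def by fastforce
  show "\<exists>\<gamma>'. continuous_on {t \<in> {c - b..c - a}. \<gamma> (c - t) \<in> U} \<gamma>' \<and>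
          (\<forall>t\<in>{t \<in> {c - b..c - a}. \<gamma> (c - t) \<in> U}.
             ((\<phi> \<circ> (\<lambda>t. \<gamma> (c - t))) has_vector_derivative \<gamma>' t)
               (at t within {t \<in> {c - b..c - a}. \<gamma> (c - t) \<in> U}))"
    unfolding J'
  proof (intro exI conjI ballI)
    \<comment> \<open>The witness is the mirrored derivative with the sign from the chain
      rule.\<close>
    show "continuous_on ((\<lambda>x. c - x) ` J) (\<lambda>t. - d (c - t))"
      by (intro continuous_intros continuous_on_compose2 [OF d(1)]) auto
    fix t assume "t \<in> (\<lambda>x. c - x) ` J"
    then have "c - t \<in> J" by auto
    from has_vector_derivative_reflect [OF d(2) [OF this]]
    show "((\<phi> \<circ> (\<lambda>t. \<gamma> (c - t))) has_vector_derivative - d (c - t))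
            (at t within (\<lambda>x. c - x) ` J)"
      by (simp add: o_def)
  qed
qed

lemma piecewise_C1_curve_reflect:
  assumes "piecewise_C1_curve X A a b \<gamma>"
  shows "piecewise_C1_curve X A (c - b) (c - a) (\<lambda>t. \<gamma> (c - t))"
proof -
  from assms obtain n and s :: "nat \<Rightarrow> real" where "a \<le> b"
    and cont: "continuous_map (top_of_set {a..b}) X \<gamma>"
    and s: "s 0 = a" "s n = b"
      "\<And>i. i < n \<Longrightarrow> s i \<le> s (Suc i) \<and> C1_curve_on A (s i) (s (Suc i)) \<gamma>"
    unfolding piecewise_C1_curve_def by blast
  show ?thesis
    unfolding piecewise_C1_curve_def
  proof (intro conjI exI allI impI)
    have "continuous_map (top_of_set {c - b..c - a}) (top_of_set {a..b}) (\<lambda>t. c - t)"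
      by (auto intro!: continuous_intros)
    from continuous_map_compose [OF this cont]
    show "continuous_map (top_of_set {c - b..c - a}) X (\<lambda>t. \<gamma> (c - t))"
      by (simp add: o_def)
    \<comment> \<open>The break points are traversed backwards, as
      \<open>\<lambda>i. c - s (n - i)\<close>, so piece \<open>i\<close> of the reflected curve
      mirrors piece \<open>n - Suc i\<close> of the original one.\<close>
    fix i assume "i < n"
    then have i: "n - Suc i < n" "Suc (n - Suc i) = n - i" by auto
    show "c - s (n - i) \<le> c - s (n - Suc i)"
      using s(3) [OF i(1)] i(2) by simp
    show "C1_curve_on A (c - s (n - i)) (c - s (n - Suc i)) (\<lambda>t. \<gamma> (c - t))"
      using s(3) [OF i(1)] i(2) by (auto intro: C1_curve_on_reflect)
  qed (use \<open>a \<le> b\<close> s in auto)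
qed

lemma piecewise_C1_curve_in_topspace:
  assumes "piecewise_C1_curve X A a b \<gamma>" "t \<in> {a..b}"
  shows "\<gamma> t \<in> topspace X"
proof -
  have "continuous_map (top_of_set {a..b}) X \<gamma>"
    using assms(1) by (simp add: piecewise_C1_curve_def)
  from continuous_map_image_subset_topspace [OF this] show ?thesis
    using assms(2) by auto
qed

lemma curve_length_reflect_le:
  assumes "riemannian_manifold X A g" "piecewise_C1_curve X A a b \<gamma>"
  shows "curve_length A g (c - b) (c - a) (\<lambda>t. \<gamma> (c - t)) \<le> curve_length A g a b \<gamma>"
proof -
  have "curve_length A g (c - b) (c - a) (\<lambda>t. \<gamma> (c - t))
      = (\<integral>\<^sup>+t. ennreal (speed A g \<gamma> (c - t)) * indicator {a..b} (c - t) \<partial>lborel)"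
    unfolding curve_length_def
  proof (intro nn_integral_cong)
    \<comment> \<open>Outside the interval both indicators vanish; inside it the curve lies in
      \<open>topspace X\<close>, so \<open>speed_reflect\<close> applies.\<close>
    fix t
    show "ennreal (speed A g (\<lambda>t. \<gamma> (c - t)) t) * indicator {c - b..c - a} t =
          ennreal (speed A g \<gamma> (c - t)) * indicator {a..b} (c - t)"
      using speed_reflect [where c = c and t = t, OF assms(1)]
        piecewise_C1_curve_in_topspace [OF assms(2), of "c - t"]
      by (auto simp: indicator_def)
  qed
  also have "\<dots> \<le> curve_length A g a b \<gamma>"
    unfolding curve_length_def
    by (rule nn_integral_lborel_reflect_le
        [of "\<lambda>t. ennreal (speed A g \<gamma> t) * indicator {a..b} t" c])
  finally show ?thesis .
qed

text \<open>A translation is a composition of two reflections.\<close>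

lemma curve_translate:
  assumes "riemannian_manifold X A g" "piecewise_C1_curve X A a b \<gamma>"
  shows "piecewise_C1_curve X A (a + h) (b + h) (\<lambda>t. \<gamma> (t - h))"
    and "curve_length A g (a + h) (b + h) (\<lambda>t. \<gamma> (t - h)) \<le> curve_length A g a b \<gamma>"
proof -
  let ?\<delta> = "\<lambda>t. \<gamma> (0 - t)"
  have \<delta>: "piecewise_C1_curve X A (0 - b) (0 - a) ?\<delta>"
    using assms(2) by (rule piecewise_C1_curve_reflect)
  have *: "0 - (h - t) = t - h" "h - (0 - t) = t + h" for t :: real by auto
  show "piecewise_C1_curve X A (a + h) (b + h) (\<lambda>t. \<gamma> (t - h))"
    using piecewise_C1_curve_reflect [OF \<delta>, of h] unfolding * .
  show "curve_length A g (a + h) (b + h) (\<lambda>t. \<gamma> (t - h)) \<le> curve_length A g a b \<gamma>"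
    using curve_length_reflect_le [OF assms(1) \<delta>, of h]
      curve_length_reflect_le [OF assms, of 0]
    unfolding * by (rule order_trans)
qed


section \<open>Concatenating curves\<close>

text \<open>Agreement on the closed interval suffices, since the derivatives are taken within a
  subset of it.\<close>

lemma C1_curve_on_cong:
  assumes "\<And>t. t \<in> {a..b} \<Longrightarrow> \<gamma> t = \<delta> t"
  shows "C1_curve_on A a b \<gamma> \<longleftrightarrow> C1_curve_on A a b \<delta>"
proof -
  have J: "{t \<in> {a..b}. \<gamma> t \<in> U} = {t \<in> {a..b}. \<delta> t \<in> U}" for U
    using assms by auto
  have D: "((\<phi> \<circ> \<gamma>) has_vector_derivative d) (at t within {t \<in> {a..b}. \<delta> t \<in> U}) \<longleftrightarrow>
           ((\<phi> \<circ> \<delta>) has_vector_derivative d) (at t within {t \<in> {a..b}. \<delta> t \<in> U})"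
    if "t \<in> {t \<in> {a..b}. \<delta> t \<in> U}" for \<phi> :: "'a \<Rightarrow> 'b" and t d U
    using that assms
    by (auto elim!: has_vector_derivative_transform [rotated 2])
  show ?thesis
    unfolding C1_curve_on_def Let_def J using D by (simp cong: ball_cong)
qed

text \<open>The speed uses the two-sided derivative at \<open>t\<close>, hence agreement on a
  neighbourhood.\<close>

lemma speed_cong:
  assumes "eventually (\<lambda>x. \<gamma> x = \<delta> x) (nhds t)"
  shows "speed A g \<gamma> t = speed A g \<delta> t"
proof -
  have t: "\<gamma> t = \<delta> t" using assms by (rule eventually_nhds_x_imp_x)
  have "vector_derivative (\<phi> \<circ> \<gamma>) (at t) = vector_derivative (\<phi> \<circ> \<delta>) (at t)"
    for \<phi> :: "'a \<Rightarrow> 'b"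
    by (rule vector_derivative_cong_eq) (use assms in \<open>auto elim: eventually_mono\<close>)
  then show ?thesis by (simp add: speed_def Let_def t)
qed

lemma piecewise_C1_curve_concat:
  assumes "piecewise_C1_curve X A a b \<gamma>" "piecewise_C1_curve X A b c \<delta>" "\<gamma> b = \<delta> b"
  shows "piecewise_C1_curve X A a c (\<lambda>t. if t \<le> b then \<gamma> t else \<delta> t)"
proof -
  let ?\<eta> = "\<lambda>t. if t \<le> b then \<gamma> t else \<delta> t"
  from assms(1) obtain n and s :: "nat \<Rightarrow> real" where "a \<le> b"
    and cont1: "continuous_map (top_of_set {a..b}) X \<gamma>"
    and s: "s 0 = a" "s n = b" "\<And>i. i < n \<Longrightarrow> s i \<le> s (Suc i)"
      "\<And>i. i < n \<Longrightarrow> C1_curve_on A (s i) (s (Suc i)) \<gamma>"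
    unfolding piecewise_C1_curve_def by blast
  from assms(2) obtain m and r :: "nat \<Rightarrow> real" where "b \<le> c"
    and cont2: "continuous_map (top_of_set {b..c}) X \<delta>"
    and r: "r 0 = b" "r m = c" "\<And>i. i < m \<Longrightarrow> r i \<le> r (Suc i)"
      "\<And>i. i < m \<Longrightarrow> C1_curve_on A (r i) (r (Suc i)) \<delta>"
    unfolding piecewise_C1_curve_def by blast
  have s_le: "s i \<le> b" if "i \<le> n" for i
    using that by (induction rule: inc_induct) (use s in \<open>auto intro: order_trans\<close>)
  have r_ge: "b \<le> r i" if "i \<le> m" for i
    using that by (induction i) (use r in \<open>auto intro: order_trans Suc_leD\<close>)
  \<comment> \<open>The break points of \<open>\<gamma>\<close>, followed by those of
    \<open>\<delta>\<close> from \<open>r 1\<close> on; \<open>r 0\<close> is already listed as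
    \<open>s n\<close>.\<close>
  let ?s = "\<lambda>i. if i \<le> n then s i else r (i - n)"
  show ?thesis
    unfolding piecewise_C1_curve_def
  proof (intro conjI exI allI impI)
    show "a \<le> c" using \<open>a \<le> b\<close> \<open>b \<le> c\<close> by simp
    have 1: "{x \<in> {a..c}. x \<le> b} = {a..b}" and 2: "{x \<in> {a..c}. b \<le> x} = {b..c}"
      using \<open>a \<le> b\<close> \<open>b \<le> c\<close> by auto
    have T: "topspace (top_of_set {a..c}) = {a..c}" by simp
    \<comment> \<open>Pasting along the two closed halves, which meet only at \<open>b\<close>,
      where the curves agree.\<close>
    show "continuous_map (top_of_set {a..c}) X ?\<eta>"
    proof (rule continuous_map_cases_le)
      show "continuous_map (top_of_set {a..c}) euclideanreal (\<lambda>t. t)"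
        "continuous_map (top_of_set {a..c}) euclideanreal (\<lambda>t. b)"
        by simp_all
      show "continuous_map (subtopology (top_of_set {a..c})
              {x \<in> topspace (top_of_set {a..c}). x \<le> b}) X \<gamma>"
        unfolding T 1 using cont1 \<open>b \<le> c\<close> by (simp add: subtopology_subtopology Int_absorb1)
      show "continuous_map (subtopology (top_of_set {a..c})
              {x \<in> topspace (top_of_set {a..c}). b \<le> x}) X \<delta>"
        unfolding T 2 using cont2 \<open>a \<le> b\<close> by (simp add: subtopology_subtopology Int_absorb1)
    qed (use assms(3) in auto)
    show "?s 0 = a" using s by simp
    show "?s (n + m) = c" using s r by auto
    fix i assume i: "i < n + m"
    show "?s i \<le> ?s (Suc i)" and "C1_curve_on A (?s i) (?s (Suc i)) ?\<eta>"
    proof -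
      have "?s i \<le> ?s (Suc i) \<and> C1_curve_on A (?s i) (?s (Suc i)) ?\<eta>"
      proof (cases "i < n")
        case True
        have "C1_curve_on A (s i) (s (Suc i)) ?\<eta>"
          using s(4) [OF True] s_le [of "Suc i"] True
          by (subst C1_curve_on_cong [where \<delta> = \<gamma>]) auto
        then show ?thesis using s(3) True by simp
      next
        case False
        then have im: "i - n < m" "Suc i - n = Suc (i - n)" using i by auto
        \<comment> \<open>For \<open>i = n\<close> the first branch of \<open>?s\<close> applies,
          and \<open>s n = b = r 0\<close>.\<close>
        have eq: "?s i = r (i - n)" "?s (Suc i) = r (Suc (i - n))"
          using False s r im by auto
        have "?\<eta> t = \<delta> t" if "r (i - n) \<le> t" for t
          using that r_ge [of "i - n"] im(1) assms(3) by (cases "t = b") auto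
        then have "C1_curve_on A (r (i - n)) (r (Suc (i - n))) ?\<eta>"
          using r(4) [OF im(1)] by (subst C1_curve_on_cong [where \<delta> = \<delta>]) auto
        then show ?thesis unfolding eq using r(3) im by simp
      qed
      then show "?s i \<le> ?s (Suc i)" "C1_curve_on A (?s i) (?s (Suc i)) ?\<eta>" by auto
    qed
  qed
qed

text \<open>Off \<open>b\<close> the joined curve coincides locally with one of its two parts. At
  the corner \<open>b\<close> its speed may be a junk value, but a single point is a null
  set.\<close>

lemma curve_length_concat_le:
  assumes "a \<le> b" "b \<le> c"
  shows "curve_length A g a c (\<lambda>t. if t \<le> b then \<gamma> t else \<delta> t)
           \<le> curve_length A g a b \<gamma> + curve_length A g b c \<delta>"
proof -
  let ?\<eta> = "\<lambda>t. if t \<le> b then \<gamma> t else \<delta> t"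
  have left: "speed A g ?\<eta> t = speed A g \<gamma> t" if "t < b" for t
    by (rule speed_cong, rule eventually_mono [OF eventually_nhds_in_open [of "{..<b}"]])
      (use that in auto)
  have right: "speed A g ?\<eta> t = speed A g \<delta> t" if "b < t" for t
    by (rule speed_cong, rule eventually_mono [OF eventually_nhds_in_open [of "{b<..}"]])
      (use that in auto)
  have ne: "AE t in lborel. t \<noteq> b" by (rule AE_lborel_singleton)
  let ?F = "\<lambda>t. ennreal (speed A g ?\<eta> t) * indicator {a..c} t"
  have "curve_length A g a c ?\<eta> \<le>
     (\<integral>\<^sup>+t\<in>{..b}. ?F t \<partial>lborel) + (\<integral>\<^sup>+t\<in>space lborel - {..b}. ?F t \<partial>lborel)"
    unfolding curve_length_def by (rule nn_integral_le_split) simp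
  also have "\<dots> \<le> curve_length A g a b \<gamma> + curve_length A g b c \<delta>"
    unfolding curve_length_def
  proof (intro add_mono nn_integral_mono_AE)
    show "AE t in lborel. ?F t * indicator {..b} t
            \<le> ennreal (speed A g \<gamma> t) * indicator {a..b} t"
      using ne by eventually_elim (auto simp: indicator_def left)
    show "AE t in lborel. ?F t * indicator (space lborel - {..b}) t
            \<le> ennreal (speed A g \<delta> t) * indicator {b..c} t"
      using ne by eventually_elim (auto simp: indicator_def right)
  qed
  finally show ?thesis .
qed


section \<open>Geodesic distance\<close>

lemma geodesic_dist_le:
  assumes "piecewise_C1_curve X A a b \<gamma>" "\<gamma> a = x" "\<gamma> b = y"
  shows "geodesic_dist X A g x y \<le> curve_length A g a b \<gamma>"
  unfolding geodesic_dist_def using assms by (intro Inf_lower) auto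

lemma geodesic_dist_greatest:
  assumes "\<And>a b \<gamma>. piecewise_C1_curve X A a b \<gamma> \<Longrightarrow> \<gamma> a = x \<Longrightarrow> \<gamma> b = y \<Longrightarrow>
             d \<le> curve_length A g a b \<gamma>"
  shows "d \<le> geodesic_dist X A g x y"
  unfolding geodesic_dist_def using assms by (intro Inf_greatest) auto

text \<open>Every curve from \<open>y\<close> to \<open>x\<close>, run backwards, is a curve from
  \<open>x\<close> to \<open>y\<close> that is not longer; exchanging the points gives the other
  inequality.\<close>

lemma geodesic_dist_commute:
  assumes "riemannian_manifold X A g"
  shows "geodesic_dist X A g x y = geodesic_dist X A g y x"
proof -
  have "geodesic_dist X A g x y \<le> geodesic_dist X A g y x" for x y
  proof (rule geodesic_dist_greatest)
    fix a b \<gamma> assume \<gamma>: "piecewise_C1_curve X A a b \<gamma>" "\<gamma> a = y" "\<gamma> b = x"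
    have "geodesic_dist X A g x y \<le> curve_length A g (0 - b) (0 - a) (\<lambda>t. \<gamma> (0 - t))"
      using \<gamma> by (intro geodesic_dist_le piecewise_C1_curve_reflect) auto
    also have "\<dots> \<le> curve_length A g a b \<gamma>"
      using assms \<gamma>(1) by (rule curve_length_reflect_le)
    finally show "geodesic_dist X A g x y \<le> curve_length A g a b \<gamma>" .
  qed
  then show ?thesis by (simp add: antisym)
qed

lemma geodesic_dist_triangle:
  assumes "riemannian_manifold X A g"
  shows "geodesic_dist X A g x z \<le> geodesic_dist X A g x y + geodesic_dist X A g y z"
proof -
  have *: "geodesic_dist X A g x z \<le> curve_length A g a b \<gamma> + curve_length A g b' c \<delta>"
    if \<gamma>: "piecewise_C1_curve X A a b \<gamma>" "\<gamma> a = x" "\<gamma> b = y"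
      and \<delta>: "piecewise_C1_curve X A b' c \<delta>" "\<delta> b' = y" "\<delta> c = z" for a b b' c \<gamma> \<delta>
  proof -
    \<comment> \<open>The parameter intervals are unrelated, so \<open>\<delta>\<close> is shifted
      to start at time \<open>b\<close>, when \<open>\<gamma>\<close> ends.\<close>
    define h where "h = b - b'"
    let ?\<delta> = "\<lambda>t. \<delta> (t - h)"
    let ?\<eta> = "\<lambda>t. if t \<le> b then \<gamma> t else ?\<delta> t"
    have b: "b' + h = b" by (simp add: h_def)
    note tr = curve_translate [OF assms \<delta>(1), of h, unfolded b]
    have le: "a \<le> b" "b \<le> c + h"
      using \<gamma>(1) tr(1) by (auto simp: piecewise_C1_curve_def)
    have "\<gamma> b = ?\<delta> b" using \<gamma> \<delta> by (simp add: h_def)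
    then have "piecewise_C1_curve X A a (c + h) ?\<eta>"
      using \<gamma>(1) tr(1) by (intro piecewise_C1_curve_concat)
    moreover have "?\<eta> a = x" using \<gamma> le by simp
    \<comment> \<open>If \<open>c + h = b\<close>, the end value comes from \<open>\<gamma>\<close>,
      and the matching condition identifies it with \<open>z\<close>.\<close>
    moreover have "?\<eta> (c + h) = z"
      using \<gamma> \<delta> le \<open>\<gamma> b = ?\<delta> b\<close> by (cases "c + h = b") auto
    ultimately have "geodesic_dist X A g x z \<le> curve_length A g a (c + h) ?\<eta>"
      by (rule geodesic_dist_le)
    also have "\<dots> \<le> curve_length A g a b \<gamma> + curve_length A g b (c + h) ?\<delta>"
      using le by (rule curve_length_concat_le)
    also have "\<dots> \<le> curve_length A g a b \<gamma> + curve_length A g b' c \<delta>"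
      by (intro add_left_mono tr(2))
    finally show ?thesis .
  qed
  show ?thesis
  proof (cases "geodesic_dist X A g x y = \<infinity> \<or> geodesic_dist X A g y z = \<infinity>")
    case True
    then show ?thesis by auto
  next
    case False
    \<comment> \<open>The two infima are taken one after the other, moving the other summand across
      by subtraction. As \<open>\<infinity> - \<infinity> = \<infinity>\<close> in
      \<open>ennreal\<close>, infinite values are treated separately.\<close>
    have "geodesic_dist X A g x z - geodesic_dist X A g y z \<le> geodesic_dist X A g x y"
    proof (rule geodesic_dist_greatest)
      fix a b \<gamma> assume \<gamma>: "piecewise_C1_curve X A a b \<gamma>" "\<gamma> a = x" "\<gamma> b = y"
      show "geodesic_dist X A g x z - geodesic_dist X A g y z \<le> curve_length A g a b \<gamma>"
      proof (cases "curve_length A g a b \<gamma> = \<infinity>")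
        case finite: False
        have "geodesic_dist X A g x z - curve_length A g a b \<gamma> \<le> geodesic_dist X A g y z"
          using * [OF \<gamma>] finite
          by (intro geodesic_dist_greatest) (auto simp: ennreal_minus_le_iff)
        then show ?thesis
          using False by (auto simp: ennreal_minus_le_iff add.commute)
      qed simp
    qed
    then show ?thesis using False by (auto simp: ennreal_minus_le_iff add.commute)
  qed
qed

text \<open>This keeps \<open>enn2real\<close> from turning an infinite distance into 0 in
  \<open>sq_dist_matrix\<close>.\<close>

lemma geodesic_dist_finite:
  assumes "diameter_of X A g < \<infinity>" "x \<in> topspace X" "y \<in> topspace X"
  shows "geodesic_dist X A g x y < \<infinity>"
proof -
  have "geodesic_dist X A g x y \<le> diameter_of X A g"
    unfolding diameter_of_def using assms(2,3) by (meson SUP_upper2 order_refl)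
  then show ?thesis using assms(1) by (rule le_less_trans)
qed


section \<open>Row sums of walk matrices\<close>

text \<open>If the total were a real \<open>r\<close>, then \<open>n\<close> indices with
  \<open>n * c > r\<close> would already contribute more than \<open>r\<close>. Neither series alone
  has terms bounded below, so the two are treated jointly.\<close>

lemma infsum_ennreal_add_eq_top:
  fixes f h :: "'b \<Rightarrow> real"
  assumes "infinite S" "0 < c" "\<And>j. j \<in> S \<Longrightarrow> c \<le> \<bar>f j\<bar> + \<bar>h j\<bar>"
  shows "(\<Sum>\<^sub>\<infinity>j\<in>S. ennreal \<bar>f j\<bar>) + (\<Sum>\<^sub>\<infinity>j\<in>S. ennreal \<bar>h j\<bar>) = \<infinity>" (is "?s = _")
proof (rule ccontr)
  assume "?s \<noteq> \<infinity>"
  then obtain r where r: "?s = ennreal r" "0 \<le> r" by (cases ?s) auto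
  have partial: "(\<Sum>j\<in>F. ennreal \<bar>u j\<bar>) \<le> (\<Sum>\<^sub>\<infinity>j\<in>S. ennreal \<bar>u j\<bar>)"
    if "finite F" "F \<subseteq> S" for F and u :: "'b \<Rightarrow> real"
    using that by (subst nonneg_infsum_complete) (auto intro!: SUP_upper)
  obtain n :: nat where n: "r < of_nat n * c"
    using reals_Archimedean3 [OF \<open>0 < c\<close>] by blast
  obtain F where F: "finite F" "F \<subseteq> S" "card F = n"
    using infinite_arbitrarily_large [OF assms(1)] by blast
  have "ennreal (of_nat n * c) = (\<Sum>j\<in>F. ennreal c)"
    using F \<open>0 < c\<close> by (simp add: ennreal_mult ennreal_of_nat_eq_real_of_nat)
  also have "\<dots> \<le> (\<Sum>j\<in>F. ennreal \<bar>f j\<bar> + ennreal \<bar>h j\<bar>)"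
    using assms(3) F by (intro sum_mono) (auto simp flip: ennreal_plus intro!: ennreal_leI)
  also have "\<dots> \<le> ?s"
    unfolding sum.distrib by (intro add_mono partial F)
  finally show False using n r \<open>0 < c\<close> by (simp add: ennreal_le_iff)
qed

text \<open>Triangle inequality through the \<open>j\<close>-th point, followed by
  \<open>(a + b)^2 \<le> 2 * (a^2 + b^2)\<close>. Symmetry puts \<open>j\<close> second in both
  terms, so that they are entries of rows \<open>i\<close> and \<open>k\<close>.\<close>

lemma sq_dist_matrix_le:
  assumes "riemannian_manifold X A g" "diameter_of X A g < \<infinity>"
    and "\<And>k. \<xi> k t \<in> topspace X"
  shows "sq_dist_matrix X A g \<xi> t i k
           \<le> 2 * (sq_dist_matrix X A g \<xi> t i j + sq_dist_matrix X A g \<xi> t k j)"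
proof -
  let ?d = "\<lambda>i j. geodesic_dist X A g (\<xi> i t) (\<xi> j t)"
  have fin: "?d i j < top" for i j
    using geodesic_dist_finite [OF assms(2,3,3)] by simp
  have "?d i k \<le> ?d i j + ?d k j"
    using geodesic_dist_triangle [OF assms(1)] geodesic_dist_commute [OF assms(1)] by metis
  then have "enn2real (?d i k) \<le> enn2real (?d i j + ?d k j)"
    using fin by (intro enn2real_mono) auto
  also have "\<dots> = enn2real (?d i j) + enn2real (?d k j)"
    using fin by (simp add: enn2real_plus)
  finally have "(enn2real (?d i k))\<^sup>2 \<le> (enn2real (?d i j) + enn2real (?d k j))\<^sup>2"
    by (intro power_mono) auto
  also have "\<dots> \<le> 2 * ((enn2real (?d i j))\<^sup>2 + (enn2real (?d k j))\<^sup>2)"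
    using sum_squares_bound [of "enn2real (?d i j)" "enn2real (?d k j)"]
    by (simp add: power2_sum)
  finally show ?thesis by (simp add: sq_dist_matrix_def)
qed

theorem theorem2:
  fixes X :: "'a topology"
    and A :: "('a, 'e::euclidean_space) chart set"
    and g :: "('a, 'e) metric_tensor"
    and \<xi> :: "int \<Rightarrow> real \<Rightarrow> 'a"
    and t0 t1 :: real
  assumes "riemannian_manifold X A g"
    and "DIM('e) > 0"
    and "diameter_of X A g < \<infinity>"
    and "\<And>k. is_walk X t0 t1 (\<xi> k)"
  shows "\<forall>t\<in>{t0..t1}. sq_dist_matrix X A g \<xi> t \<in> walk_matrices X A g \<xi> {t0..t1} \<longrightarrow>
           matrix_norm_inf (sq_dist_matrix X A g \<xi> t) = \<infinity>"
proof (intro ballI impI)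
  fix t assume t: "t \<in> {t0..t1}"
    and walk: "sq_dist_matrix X A g \<xi> t \<in> walk_matrices X A g \<xi> {t0..t1}"
  let ?D = "sq_dist_matrix X A g \<xi> t"
  let ?row = "\<lambda>i. \<Sum>\<^sub>\<infinity>j\<in>UNIV. ennreal \<bar>?D i j\<bar>"
  have "\<xi> k t \<in> topspace X" for k
    using continuous_map_image_subset_topspace [OF assms(4) [of k, unfolded is_walk_def]] t
    by auto
  note le = sq_dist_matrix_le [of X A g \<xi> t 0 1, OF assms(1,3) this]
  \<comment> \<open>Membership may be witnessed by another time with the same matrix, but positivity
    is demanded at every time of the interval, hence at \<open>t\<close>.\<close>
  have "0 < ?D 0 1"
    using walk t unfolding walk_matrices_def by auto
  \<comment> \<open>The positive lower bound, independent of \<open>j\<close>, is half of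
    \<open>?D 0 1\<close> because of the factor 2 in \<open>le\<close>.\<close>
  moreover have "?D 0 1 / 2 \<le> \<bar>?D 0 j\<bar> + \<bar>?D 1 j\<bar>" for j
    using le [of j] abs_ge_self [of "?D 0 j"] abs_ge_self [of "?D 1 j"] by (simp add: field_simps)
  ultimately have "?row 0 + ?row 1 = \<infinity>"
    by (intro infsum_ennreal_add_eq_top [where c = "?D 0 1 / 2"]) auto
  moreover have "?row i \<le> matrix_norm_inf ?D" for i
    unfolding matrix_norm_inf_def by (rule SUP_upper) simp
  \<comment> \<open>A sum of two extended reals is infinite only if one of them is, and either row
    sum lies below the norm.\<close>
  ultimately show "matrix_norm_inf ?D = \<infinity>"
    by (metis ennreal_add_eq_top infinity_ennreal_def top.extremum_uniqueI)
qed

end
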